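(* Let $q,p_0\in\mathbb N$ with $p_0\ge q$, let $\kappa\in\mathbb N_0^{p_0\times q}$, regarded for every $p\ge p_0$ as an element of $\mathbb N_0^{p\times q}$ by adding zero rows, and let $l:=|\kappa|/2$. Let $\nu$ be a Borel probability measure on $\Pi_q$ and, for $p\ge p_0$, let $\nu_p$ be the corresponding radial probability measure on $\mathbb M_{p,q}$; assume that $\nu_p$ admits a moment of order $|\kappa|$, i.e. $\int_{\mathbb M_{p,q}}\|z\|^{|\kappa|}\,d\nu_p(z)=\int_{\Pi_q}\|s\|^{|\kappa|}\,d\nu(s)<\infty$. Then the $\kappa$-th moment $m_\kappa(\nu_p)=\int_{\mathbb M_{p,q}}z^\kappa\,d\nu_p(z)$ exists in $\mathbb R$ and behaves as follows as $p\to\infty$. (a) If $R_i(\kappa)$ is even for all $i$, then $m_\kappa(\nu_p)=O(p^{-l})$ as $p\to\infty$. (b) If $R_i(\kappa)$ is not even for some $i$, then $m_\kappa(\nu_p)=0$.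
   Context: $\mathbb M_{p,q}$ is the space of real $p\times q$ matrices, $\|x\|=\sqrt{\mathrm{tr}(x'x)}$ with $x'$ the transpose, and $\Pi_q$ is the cone of positive semidefinite symmetric real $q\times q$ matrices. A measure on $\mathbb M_{p,q}$ is radial if it is invariant under $x\mapsto Ax$ for all $A$ in the orthogonal group $\mathbb O_p$. For $p\ge q$, $\nu_p$ is the unique radial probability measure on $\mathbb M_{p,q}$ whose image under $\varphi_p(x)=\sqrt{x'x}$ is $\nu$. For $\kappa\in\mathbb N_0^{p\times q}$: $|\kappa|=\sum_{i,j}\kappa_{ij}$, $R_i(\kappa)=\sum_{j=1}^q\kappa_{ij}$, $z^\kappa=\prod_{i,j}z_{ij}^{\kappa_{ij}}$. *)

theory Defs
  imports
    "HOL-Probability.Probability"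
    "HOL-Library.Landau_Symbols"
    "Jordan_Normal_Form.Matrix"
begin

definition mat_trace :: "real mat \<Rightarrow> real" where
  "mat_trace a = (\<Sum>i<dim_row a. a $$ (i, i))"

definition mat_norm :: "real mat \<Rightarrow> real" where
  "mat_norm x = sqrt (mat_trace (transpose_mat x * x))"

definition psd_cone :: "nat \<Rightarrow> real mat set" where
  "psd_cone q = {a \<in> carrier_mat q q. transpose_mat a = a \<and>
     (\<forall>v\<in>carrier_vec q. 0 \<le> scalar_prod v (a *\<^sub>v v))}"

definition orthogonal_group :: "nat \<Rightarrow> real mat set" where
  "orthogonal_group p = {A \<in> carrier_mat p p. transpose_mat A * A = 1\<^sub>m p}"

text \<open>The unique positive semidefinite square root of a positive semidefinite matrix.\<close>

definition mat_sqrt :: "real mat \<Rightarrow> real mat" where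
  "mat_sqrt a = (THE s. s \<in> psd_cone (dim_row a) \<and> s * s = a)"

definition mat_abs :: "real mat \<Rightarrow> real mat" where
  "mat_abs x = mat_sqrt (transpose_mat x * x)"

text \<open>The type of matrices carries no topology. The Borel sigma-algebra on the real
  \<open>p \<times> q\<close> matrices is the pullback of the product (hence Borel) sigma-algebra on
  \<open>\<real>\<^bsup>p \<times> q\<^esup>\<close> along the bijection sending a matrix to its family of entries.\<close>

definition borel_mat :: "nat \<Rightarrow> nat \<Rightarrow> real mat measure" where
  "borel_mat p q = vimage_algebra (carrier_mat p q)
     (\<lambda>x. \<lambda>ij\<in>{..<p} \<times> {..<q}. x $$ ij)
     (\<Pi>\<^sub>M ij\<in>{..<p} \<times> {..<q}. borel)"

definition borel_psd :: "nat \<Rightarrow> real mat measure" where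
  "borel_psd q = restrict_space (borel_mat q q) (psd_cone q)"

definition radial :: "nat \<Rightarrow> real mat measure \<Rightarrow> bool" where
  "radial p \<mu> \<longleftrightarrow> (\<forall>A\<in>orthogonal_group p. distr \<mu> \<mu> (\<lambda>x. A * x) = \<mu>)"

text \<open>For \<open>q \<le> p\<close> and a Borel probability measure \<open>\<nu>\<close> on the cone there is exactly one
  \<open>\<mu>\<close> with this property.\<close>

definition radial_prob_with_radial_part ::
    "nat \<Rightarrow> nat \<Rightarrow> real mat measure \<Rightarrow> real mat measure \<Rightarrow> bool" where
  "radial_prob_with_radial_part p q \<nu> \<mu> \<longleftrightarrow>
     prob_space \<mu> \<and> sets \<mu> = sets (borel_mat p q) \<and> radial p \<mu> \<and>
     distr \<mu> (borel_psd q) mat_abs = \<nu>"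

definition row_degree :: "nat mat \<Rightarrow> nat \<Rightarrow> nat" where
  "row_degree \<kappa> i = (\<Sum>j<dim_col \<kappa>. \<kappa> $$ (i, j))"

definition mat_degree :: "nat mat \<Rightarrow> nat" where
  "mat_degree \<kappa> = (\<Sum>i<dim_row \<kappa>. \<Sum>j<dim_col \<kappa>. \<kappa> $$ (i, j))"

definition mat_monom :: "real mat \<Rightarrow> nat mat \<Rightarrow> real" where
  "mat_monom z \<kappa> = (\<Prod>i<dim_row \<kappa>. \<Prod>j<dim_col \<kappa>. z $$ (i, j) ^ \<kappa> $$ (i, j))"

definition mat_moment :: "nat mat \<Rightarrow> real mat measure \<Rightarrow> real" where
  "mat_moment \<kappa> \<mu> = (\<integral>z. mat_monom z \<kappa> \<partial>\<mu>)"

text \<open>Only meant for \<open>p \<ge> dim_row \<kappa>\<close>; the result then has exactly \<open>p\<close> rows.\<close>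

definition add_zero_rows :: "nat \<Rightarrow> nat mat \<Rightarrow> nat mat" where
  "add_zero_rows p \<kappa> = \<kappa> @\<^sub>r 0\<^sub>m (p - dim_row \<kappa>) (dim_col \<kappa>)"

end

theory Submission
  imports
    Defs
    "Jordan_Normal_Form.Spectral_Radius"
begin

text \<open>
  Everything rests on one remark: a unit vector of \<open>\<real>\<^sup>p\<close> can be any chosen row of some orthogonal
  matrix \<open>A\<close> (\<open>orthogonal_with_prescribed_row\<close>). Since \<open>\<nu>\<^sub>p\<close> is invariant under \<open>x \<mapsto> A x\<close>, an entry
  \<open>z\<^sub>i\<^sub>j\<close> has the same distribution under \<open>\<nu>\<^sub>p\<close> as every linear combination
  \<open>\<Sum>\<^sub>k u\<^sub>k z\<^sub>k\<^sub>j\<close> of column \<open>j\<close> with \<open>\<Sum>\<^sub>k u\<^sub>k\<^sup>2 = 1\<close>.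

  For the decay rate, take \<open>u = \<epsilon> / sqrt p\<close> with signs \<open>\<epsilon>\<^sub>k \<in> {1, -1}\<close>. Then the moment of \<open>z\<^sub>i\<^sub>j\<close> of
  order \<open>2 l\<close> is \<open>p\<close> to the power \<open>-l\<close> times the moment of \<open>\<Sum>\<^sub>k \<epsilon>\<^sub>k z\<^sub>k\<^sub>j\<close>, for each of the \<open>2\<^sup>p\<close> choices of
  \<open>\<epsilon>\<close>, hence also on average over \<open>\<epsilon>\<close>. Khinchine's inequality (\<open>khinchine_even_moment\<close>) bounds the
  average of \<open>(\<Sum>\<^sub>k \<epsilon>\<^sub>k z\<^sub>k\<^sub>j)\<close> to the power \<open>2 l\<close>, pointwise in \<open>z\<close>, by a constant depending only on \<open>l\<close>
  times \<open>(\<Sum>\<^sub>k z\<^sub>k\<^sub>j\<^sup>2)\<close> to the power \<open>l\<close>, which is at most the corresponding power of \<open>\<parallel>z\<parallel>\<close>. So each single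
  entry already has a moment of the claimed order (\<open>even_entry_moment_bound\<close>). A monomial of
  degree \<open>2 l\<close> reduces to single entries because a product of powers is at most the same total
  power of its largest factor, hence at most the sum of these powers over the \<open>p\<^sub>0 q\<close> entries that
  can occur, a number that does not grow with \<open>p\<close>. This argument avoids integration over the
  orthogonal group.

  For a row of odd degree, flipping the sign of that row is orthogonal and negates the monomial,
  so the moment vanishes.

  The norm moments of \<open>\<nu>\<^sub>p\<close> and \<open>\<nu>\<close> agree because \<open>x\<close> and \<open>sqrt (x' x)\<close> have the same norm. As the
  square root is given by a definite description, this needs existence and uniqueness of positive
  semidefinite square roots, both of which follow from the diagonalization of real symmetric
  matrices; that is proved by splitting off one eigenvector with the same lemma on prescribed rows.
\<close>

section \<open>Orthogonal matrices with a prescribed row\<close>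

text \<open>Carrier facts with concrete dimensions: the general rules have an inner dimension that the
  simplifier would have to guess.\<close>

lemma mat_diag_mult_carrier [simp]:
  "A \<in> carrier_mat n m \<Longrightarrow> mat_diag n d * A \<in> carrier_mat n m"
  "A \<in> carrier_mat m n \<Longrightarrow> A * mat_diag n d \<in> carrier_mat m n"
  "v \<in> carrier_vec n \<Longrightarrow> mat_diag n d *\<^sub>v v \<in> carrier_vec n"
  by (meson mat_diag_dim mult_carrier_mat mult_mat_vec_carrier)+

lemma orthogonal_groupD:
  assumes "A \<in> orthogonal_group n"
  shows "A \<in> carrier_mat n n" "transpose_mat A * A = 1\<^sub>m n" "A * transpose_mat A = 1\<^sub>m n"
  using assms mat_mult_left_right_inverse[of "transpose_mat A" n A]
  by (auto simp: orthogonal_group_def)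

lemma orthogonal_group_mult:
  assumes "A \<in> orthogonal_group n" "B \<in> orthogonal_group n"
  shows "A * B \<in> orthogonal_group n"
proof -
  note A = orthogonal_groupD[OF assms(1)] and B = orthogonal_groupD[OF assms(2)]
  have "transpose_mat (A * B) * (A * B) = transpose_mat B * (transpose_mat A * A) * B"
    using A(1) B(1) by (simp add: transpose_mult[OF A(1) B(1)] assoc_mult_mat[of _ n n _ n _ n])
  then show ?thesis
    using A B by (simp add: orthogonal_group_def)
qed

text \<open>The reflection that exchanges \<open>e\<^sub>i\<close> and the unit vector \<open>u\<close> does it: with \<open>w = e\<^sub>i - u\<close> it is
  \<open>1 - c w w'\<close> for \<open>c = 2 / (w' w) = 1 / (1 - u\<^sub>i)\<close>, and being symmetric it has \<open>u\<close> both as its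
  column and as its row \<open>i\<close>.\<close>

lemma orthogonal_with_prescribed_row:
  fixes u :: "nat \<Rightarrow> real"
  assumes i: "i < p" and u: "(\<Sum>k<p. (u k)\<^sup>2) = 1"
  obtains A where "A \<in> orthogonal_group p" "\<And>k. k < p \<Longrightarrow> A $$ (i, k) = u k"
proof -
  define \<delta> :: "nat \<Rightarrow> nat \<Rightarrow> real" where "\<delta> a b = (if a = b then 1 else 0)" for a b
  define w where "w k = \<delta> i k - u k" for k
  \<comment> \<open>the usual factor \<open>2 / (w' w)\<close> of the reflection along \<open>w\<close>, since \<open>w' w = 2 * (1 - u i)\<close>\<close>
  define c where "c = 1 / (1 - u i)"
  define A where "A = Matrix.mat p p (\<lambda>(a, b). \<delta> a b - c * w a * w b)"
  have \<delta>_sum: "(\<Sum>k<p. \<delta> a k * f k) = f a" if "a < p" for a and f :: "nat \<Rightarrow> real"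
    using that by (simp add: \<delta>_def if_distrib[of "\<lambda>x. x * _"] cong: if_cong)
  have \<delta>_sq: "\<delta> a b * \<delta> a b = \<delta> a b" for a b by (simp add: \<delta>_def)
  have w_sq: "(\<Sum>k<p. (w k)\<^sup>2) = 2 * (1 - u i)"
  proof -
    have "(\<Sum>k<p. (w k)\<^sup>2) = (\<Sum>k<p. \<delta> i k * (1 - 2 * u k) + (u k)\<^sup>2)"
      by (intro sum.cong) (auto simp: w_def power2_eq_square algebra_simps \<delta>_sq)
    also have "\<dots> = 2 * (1 - u i)"
      using i u by (simp add: sum.distrib \<delta>_sum)
    finally show ?thesis .
  qed
  \<comment> \<open>If \<open>u i = 1\<close> then \<open>w\<close> vanishes and so does \<open>c\<close>; the reflection degenerates to the identity.\<close>
  have c: "c * c * (\<Sum>k<p. (w k)\<^sup>2) = 2 * c"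
    unfolding w_sq by (cases "u i = 1") (auto simp: c_def divide_simps)
  have "transpose_mat A * A = 1\<^sub>m p"
  proof (rule eq_matI)
    fix a b assume "a < dim_row (1\<^sub>m p :: real mat)" "b < dim_col (1\<^sub>m p :: real mat)"
    then have ab: "a < p" "b < p" by auto
    have "(transpose_mat A * A) $$ (a, b) = (\<Sum>k<p. A $$ (k, a) * A $$ (k, b))"
      using ab by (simp add: A_def scalar_prod_def atLeast0LessThan)
    also have "\<dots> = (\<Sum>k<p. \<delta> a k * (\<delta> k b - c * w k * w b) - \<delta> b k * (c * w k * w a)
                          + c * c * w a * w b * (w k)\<^sup>2)"
      using ab by (intro sum.cong)
        (auto simp: A_def algebra_simps power2_eq_square \<delta>_def)
    also have "\<dots> = \<delta> a b - 2 * c * w a * w b + c * c * w a * w b * (\<Sum>k<p. (w k)\<^sup>2)"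
      using ab by (simp add: sum.distrib sum_subtractf \<delta>_sum sum_distrib_left[symmetric])
    also have "\<dots> = \<delta> a b - 2 * c * w a * w b + (c * c * (\<Sum>k<p. (w k)\<^sup>2)) * w a * w b"
      by (simp add: mult.commute mult.left_commute)
    also have "\<dots> = \<delta> a b"
      unfolding c by simp
    finally show "(transpose_mat A * A) $$ (a, b) = 1\<^sub>m p $$ (a, b)"
      using ab by (simp add: \<delta>_def)
  qed (auto simp: A_def)
  then have "A \<in> orthogonal_group p"
    by (auto simp: orthogonal_group_def A_def)
  moreover have "A $$ (i, k) = u k" if k: "k < p" for k
  proof (cases "u i = 1")
    case True
    have "w k = 0"
      using w_sq True k by (simp add: sum_nonneg_eq_0_iff)
    then show ?thesis using i k by (simp add: A_def w_def)
  next
    case False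
    then have "c * w i = 1" by (simp add: c_def w_def \<delta>_def)
    then show ?thesis using i k by (simp add: A_def) (simp add: w_def)
  qed
  ultimately show ?thesis by (rule that)
qed


section \<open>Diagonalization of real symmetric matrices\<close>

lemma symmetric_index:
  assumes "A \<in> carrier_mat n n" "transpose_mat A = A" "i < n" "j < n"
  shows "A $$ (i, j) = A $$ (j, i)"
  using assms by (metis index_transpose_mat(1) carrier_matD)

text \<open>Take a complex eigenvector \<open>a + \<i> b\<close> with eigenvalue \<open>k\<close>. Comparing \<open>(A a)' b\<close> with \<open>a' (A b)\<close>
  gives \<open>Im k * (a' a + b' b) = 0\<close>, so \<open>k\<close> is real and \<open>a\<close> or \<open>b\<close> is a real eigenvector.\<close>

lemma symmetric_real_eigenvector:
  fixes A :: "real mat"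
  assumes A: "A \<in> carrier_mat n n" and sym: "transpose_mat A = A" and n: "0 < n"
  obtains e u where "(\<Sum>j<n. (u j)\<^sup>2) = 1" "\<And>i. i < n \<Longrightarrow> (\<Sum>j<n. A $$ (i, j) * u j) = e * u i"
proof -
  let ?C = "map_mat complex_of_real A"
  have C: "?C \<in> carrier_mat n n" using A by simp
  obtain k where "eigenvalue ?C k"
    using spectrum_non_empty[OF C n] by (auto simp: spectrum_def)
  then obtain w where w: "w \<in> carrier_vec n" "w \<noteq> 0\<^sub>v n" "?C *\<^sub>v w = k \<cdot>\<^sub>v w"
    using C by (auto simp: eigenvalue_def eigenvector_def)
  define a b where "a i = Re (vec_index w i)" and "b i = Im (vec_index w i)" for i
  have eq: "(\<Sum>j<n. complex_of_real (A $$ (i, j)) * vec_index w j) = k * vec_index w i" if "i < n" for i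
  proof -
    have "vec_index (?C *\<^sub>v w) i = (\<Sum>j<n. complex_of_real (A $$ (i, j)) * vec_index w j)"
      using that A w(1) by (simp add: scalar_prod_def atLeast0LessThan)
    then show ?thesis using that w by simp
  qed
  have re: "(\<Sum>j<n. A $$ (i, j) * a j) = Re k * a i - Im k * b i" if "i < n" for i
    using arg_cong[OF eq[OF that], of Re] by (simp add: a_def b_def)
  have im: "(\<Sum>j<n. A $$ (i, j) * b j) = Re k * b i + Im k * a i" if "i < n" for i
    using arg_cong[OF eq[OF that], of Im] by (simp add: a_def b_def)
  have "(\<Sum>i<n. \<Sum>j<n. A $$ (i, j) * a j * b i) = (\<Sum>i<n. \<Sum>j<n. A $$ (i, j) * a i * b j)"
    by (subst sum.swap, intro sum.cong refl) (use A sym in \<open>simp add: symmetric_index[OF A sym]\<close>)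
  moreover have "(\<Sum>i<n. \<Sum>j<n. A $$ (i, j) * a j * b i) = (\<Sum>i<n. (Re k * a i - Im k * b i) * b i)"
    by (intro sum.cong refl) (simp add: re[symmetric] sum_distrib_right)
  moreover have "(\<Sum>i<n. \<Sum>j<n. A $$ (i, j) * a i * b j) = (\<Sum>i<n. a i * (Re k * b i + Im k * a i))"
    by (intro sum.cong refl) (simp add: im[symmetric] sum_distrib_left mult.left_commute mult.assoc)
  ultimately have "(\<Sum>i<n. (Re k * a i - Im k * b i) * b i) = (\<Sum>i<n. a i * (Re k * b i + Im k * a i))"
    by simp
  then have "(\<Sum>i<n. Im k * ((a i)\<^sup>2 + (b i)\<^sup>2)) = 0"
    unfolding right_diff_distrib
    by (simp add: algebra_simps power2_eq_square sum.distrib sum_subtractf sum_distrib_left)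
  then have "Im k * (\<Sum>i<n. (a i)\<^sup>2 + (b i)\<^sup>2) = 0"
    by (simp only: sum_distrib_left)
  moreover obtain i0 where i0: "i0 < n" "vec_index w i0 \<noteq> 0"
    using w(1,2) by (metis carrier_vecD eq_vecI index_zero_vec)
  then have "(\<Sum>i<n. (a i)\<^sup>2 + (b i)\<^sup>2) \<noteq> 0"
    by (subst sum_nonneg_eq_0_iff) (auto simp: a_def b_def complex_eq_iff sum_power2_eq_zero_iff)
  ultimately have k: "Im k = 0" by simp
  obtain v where v: "\<exists>i<n. v i \<noteq> 0" "\<And>i. i < n \<Longrightarrow> (\<Sum>j<n. A $$ (i, j) * v j) = Re k * v i"
  proof (cases "a i0 = 0")
    case True
    then have "b i0 \<noteq> 0" using i0 by (auto simp: a_def b_def complex_eq_iff)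
    then show ?thesis using that[of b] im i0 k by auto
  qed (use that[of a] re i0 k in auto)
  define s where "s = sqrt (\<Sum>j<n. (v j)\<^sup>2)"
  have "(\<Sum>j<n. (v j)\<^sup>2) > 0"
    using v(1) by (auto intro!: sum_pos2)
  then have s: "s > 0" "s\<^sup>2 = (\<Sum>j<n. (v j)\<^sup>2)" by (auto simp: s_def)
  have "(\<Sum>j<n. (v j / s)\<^sup>2) = 1"
    using s by (simp add: power_divide sum_divide_distrib[symmetric] flip: s(2))
  moreover have "(\<Sum>j<n. A $$ (i, j) * (v j / s)) = Re k * (v i / s)" if "i < n" for i
    using v(2)[OF that] by (simp add: sum_divide_distrib[symmetric])
  ultimately show ?thesis by (rule that)
qed

text \<open>Conjugating with an orthogonal matrix whose first row is a unit eigenvector makes the first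
  column a multiple of \<open>e\<^sub>0\<close>; symmetry clears the first row too, and the remaining block is
  symmetric of smaller size.\<close>

theorem symmetric_diagonalization:
  fixes A :: "real mat"
  assumes "A \<in> carrier_mat n n" and "transpose_mat A = A"
  shows "\<exists>P\<in>orthogonal_group n. \<exists>d. A = transpose_mat P * (mat_diag n d * P)"
  using assms
proof (induction n arbitrary: A)
  case 0
  then show ?case
    by (intro bexI[of _ "1\<^sub>m 0"] exI[of _ "\<lambda>_. 0"]) (auto simp: orthogonal_group_def)
next
  case (Suc n A)
  note A = Suc.prems(1) and sym = Suc.prems(2)
  obtain e u where u: "(\<Sum>j<Suc n. (u j)\<^sup>2) = 1"
    and eig: "\<And>i. i < Suc n \<Longrightarrow> (\<Sum>j<Suc n. A $$ (i, j) * u j) = e * u i"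
    using symmetric_real_eigenvector[OF A sym] by blast
  obtain H where H: "H \<in> orthogonal_group (Suc n)" and row: "\<And>k. k < Suc n \<Longrightarrow> H $$ (0, k) = u k"
    using orthogonal_with_prescribed_row[of 0 "Suc n" u] u by auto
  note Hc = orthogonal_groupD[OF H]
  define B where "B = H * A * transpose_mat H"
  have B: "B \<in> carrier_mat (Suc n) (Suc n)" using Hc A by (simp add: B_def)
  have B_sym: "transpose_mat B = B"
    using Hc(1) A sym
    by (simp add: B_def transpose_mult[of _ "Suc n" "Suc n" _ "Suc n"]
        assoc_mult_mat[of _ "Suc n" "Suc n" _ "Suc n" _ "Suc n"])
  have B0: "B $$ (i, 0) = (if i = 0 then e else 0)" if i: "i < Suc n" for i
  proof -
    have "B = H * (A * transpose_mat H)"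
      using Hc(1) A by (simp add: B_def assoc_mult_mat[of _ "Suc n" "Suc n" _ "Suc n" _ "Suc n"])
    then have "B $$ (i, 0) = (\<Sum>k<Suc n. H $$ (i, k) * (\<Sum>j<Suc n. A $$ (k, j) * u j))"
      using i Hc(1) A row by (simp add: scalar_prod_def atLeast0LessThan del: sum.lessThan_Suc)
    also have "\<dots> = (\<Sum>k<Suc n. e * (H $$ (i, k) * H $$ (0, k)))"
      by (intro sum.cong refl) (simp add: eig row del: sum.lessThan_Suc)
    also have "\<dots> = e * (\<Sum>k<Suc n. H $$ (i, k) * H $$ (0, k))"
      by (simp only: sum_distrib_left)
    also have "(\<Sum>k<Suc n. H $$ (i, k) * H $$ (0, k)) = (H * transpose_mat H) $$ (i, 0)"
      using i Hc(1) by (simp add: scalar_prod_def atLeast0LessThan del: sum.lessThan_Suc)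
    also have "e * \<dots> = (if i = 0 then e else 0)"
      using i by (simp add: Hc(3))
    finally show ?thesis .
  qed
  define A' where "A' = Matrix.mat n n (\<lambda>(i, j). B $$ (Suc i, Suc j))"
  have A': "A' \<in> carrier_mat n n" by (simp add: A'_def)
  have "transpose_mat A' = A'"
    by (rule eq_matI) (auto simp: A'_def symmetric_index[OF B B_sym])
  then obtain P' d' where P': "P' \<in> orthogonal_group n"
    and A'_eq: "A' = transpose_mat P' * (mat_diag n d' * P')"
    using Suc.IH[OF A'] by blast
  note P'c = orthogonal_groupD[OF P']
  define d where "d i = (case i of 0 \<Rightarrow> e | Suc j \<Rightarrow> d' j)" for i
  define P where "P = four_block_mat (1\<^sub>m 1) (0\<^sub>m 1 n) (0\<^sub>m n 1) P'"
  have Pt: "transpose_mat P = four_block_mat (1\<^sub>m 1) (0\<^sub>m 1 n) (0\<^sub>m n 1) (transpose_mat P')"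
    using P'c unfolding P_def by (subst transpose_four_block_mat[of _ 1 1 _ n _ n]) auto
  define E where "E = mat_diag 1 (\<lambda>_. e)"
  define D' where "D' = mat_diag n d'"
  have E: "E \<in> carrier_mat 1 1" and D': "D' \<in> carrier_mat n n"
    by (simp_all add: E_def D'_def)
  have D: "mat_diag (Suc n) d = four_block_mat E (0\<^sub>m 1 n) (0\<^sub>m n 1) D'"
    by (rule eq_matI) (auto simp: E_def D'_def mat_diag_def d_def split: nat.split)
  have "transpose_mat P * P = 1\<^sub>m (Suc n)"
    unfolding Pt unfolding P_def
    by (subst mult_four_block_mat[of _ 1 1 _ n _ n _ _ 1 _ n]) (use P'c in auto)
  then have P: "P \<in> orthogonal_group (Suc n)"
    using P'c by (auto simp: orthogonal_group_def P_def)
  note Pc = orthogonal_groupD[OF P]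
  have "B = four_block_mat E (0\<^sub>m 1 n) (0\<^sub>m n 1) A'"
  proof (rule eq_matI)
    fix i j assume "i < dim_row (four_block_mat E (0\<^sub>m 1 n) (0\<^sub>m n 1) A')"
      "j < dim_col (four_block_mat E (0\<^sub>m 1 n) (0\<^sub>m n 1) A')"
    then have ij: "i < Suc n" "j < Suc n" by (auto simp: A'_def E_def mat_diag_def)
    then show "B $$ (i, j) = four_block_mat E (0\<^sub>m 1 n) (0\<^sub>m n 1) A' $$ (i, j)"
      using B0[of i] B0[of j] symmetric_index[OF B B_sym, of 0 j]
      by (cases i; cases j) (auto simp: A'_def E_def mat_diag_def)
  qed (use B in \<open>auto simp: A'_def E_def mat_diag_def\<close>)
  also have "\<dots> = transpose_mat P * (mat_diag (Suc n) d * P)"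
  proof -
    have "mat_diag (Suc n) d * P
        = four_block_mat E (0\<^sub>m 1 n) (0\<^sub>m n 1) (D' * P')"
      unfolding D unfolding P_def
      by (subst mult_four_block_mat[of _ 1 1 _ n _ n _ _ 1 _ n]) (use P'c E D' in auto)
    then show ?thesis
      unfolding Pt A'_eq D'_def[symmetric]
      by (simp only:, subst mult_four_block_mat[of _ 1 1 _ n _ n _ _ 1 _ n]) (use P'c E D' in auto)
  qed
  finally have BP: "B = transpose_mat P * (mat_diag (Suc n) d * P)" .
  have "transpose_mat (P * H) * (mat_diag (Suc n) d * (P * H))
      = transpose_mat H * (transpose_mat P * (mat_diag (Suc n) d * P)) * H"
    using Pc(1) Hc(1)
    by (simp add: transpose_mult[OF Pc(1) Hc(1)] assoc_mult_mat[of _ "Suc n" "Suc n" _ "Suc n" _ "Suc n"])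
  also have "\<dots> = transpose_mat H * (H * A * transpose_mat H) * H"
    by (simp only: BP[symmetric] B_def)
  also have "\<dots> = (transpose_mat H * H) * A * (transpose_mat H * H)"
    using Hc(1) A by (simp add: assoc_mult_mat[of _ "Suc n" "Suc n" _ "Suc n" _ "Suc n"])
  also have "\<dots> = A"
    using A by (simp add: Hc(2))
  finally show ?case
    using orthogonal_group_mult[OF P H] by metis
qed

section \<open>Positive semidefinite square roots\<close>

lemma psd_coneD:
  assumes "a \<in> psd_cone n"
  shows "a \<in> carrier_mat n n" "transpose_mat a = a"
    "\<And>v. v \<in> carrier_vec n \<Longrightarrow> 0 \<le> scalar_prod v (a *\<^sub>v v)"
  using assms by (auto simp: psd_cone_def)

lemma scalar_prod_mult_mat_vec:
  fixes A :: "real mat"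
  assumes "A \<in> carrier_mat m n" "x \<in> carrier_vec n" "y \<in> carrier_vec m"
  shows "scalar_prod x (transpose_mat A *\<^sub>v y) = scalar_prod (A *\<^sub>v x) y"
  using transpose_vec_mult_scalar[OF assms] assms
  by (metis comm_scalar_prod mult_mat_vec_carrier transpose_carrier_mat)

lemma mat_diag_mult_vec:
  assumes "v \<in> carrier_vec n" "i < n"
  shows "vec_index (mat_diag n d *\<^sub>v v) i = (d i :: real) * vec_index v i"
proof -
  show ?thesis
    using assms
    by (simp add: mat_diag_def scalar_prod_def atLeast0LessThan if_distrib[of "\<lambda>x. x * _"]
        cong: if_cong)
qed

lemma quadratic_form_diagonalized:
  assumes P: "P \<in> carrier_mat n n" and v: "v \<in> carrier_vec n"
  shows "scalar_prod v ((transpose_mat P * (mat_diag n d * P)) *\<^sub>v v)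
    = (\<Sum>i<n. d i * (vec_index (P *\<^sub>v v) i :: real)\<^sup>2)"
proof -
  have Pv: "P *\<^sub>v v \<in> carrier_vec n" using P v by simp
  have "(transpose_mat P * (mat_diag n d * P)) *\<^sub>v v = transpose_mat P *\<^sub>v (mat_diag n d *\<^sub>v (P *\<^sub>v v))"
    using P v by (simp add: assoc_mult_mat_vec[of _ n n _ n])
  then have "scalar_prod v ((transpose_mat P * (mat_diag n d * P)) *\<^sub>v v)
      = scalar_prod (P *\<^sub>v v) (mat_diag n d *\<^sub>v (P *\<^sub>v v))"
    using scalar_prod_mult_mat_vec[OF P v, of "mat_diag n d *\<^sub>v (P *\<^sub>v v)"] Pv
    by (metis mat_diag_dim mult_mat_vec_carrier)
  also have "\<dots> = (\<Sum>i<n. vec_index (P *\<^sub>v v) i * vec_index (mat_diag n d *\<^sub>v (P *\<^sub>v v)) i)"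
    using P by (simp add: scalar_prod_def atLeast0LessThan mat_diag_def del: index_mult_mat_vec)
  also have "\<dots> = (\<Sum>i<n. d i * (vec_index (P *\<^sub>v v) i)\<^sup>2)"
    by (intro sum.cong refl)
      (simp add: mat_diag_mult_vec[OF Pv] power2_eq_square del: index_mult_mat_vec)
  finally show ?thesis .
qed

text \<open>The rows of \<open>P\<close> are unit eigenvectors, so the diagonal entries are values of the quadratic
  form; in particular they are nonnegative for a positive semidefinite matrix.\<close>

lemma quadratic_form_eigenbasis:
  assumes P: "P \<in> orthogonal_group n" and i: "i < n"
  shows "scalar_prod (transpose_mat P *\<^sub>v unit_vec n i)
      ((transpose_mat P * (mat_diag n d * P)) *\<^sub>v (transpose_mat P *\<^sub>v unit_vec n i)) = d i"
proof -
  note Pc = orthogonal_groupD[OF P]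
  have "P *\<^sub>v (transpose_mat P *\<^sub>v unit_vec n i) = unit_vec n i"
    using Pc by (simp add: assoc_mult_mat_vec[of _ n n _ n, symmetric])
  moreover have "transpose_mat P *\<^sub>v unit_vec n i \<in> carrier_vec n"
    using Pc by simp
  ultimately have "scalar_prod (transpose_mat P *\<^sub>v unit_vec n i)
      ((transpose_mat P * (mat_diag n d * P)) *\<^sub>v (transpose_mat P *\<^sub>v unit_vec n i))
      = (\<Sum>j<n. d j * (vec_index (unit_vec n i) j)\<^sup>2)"
    using quadratic_form_diagonalized[OF Pc(1)] by metis
  also have "\<dots> = (\<Sum>j<n. if j = i then d j else 0)"
    using i by (intro sum.cong) auto
  finally show ?thesis using i by simp
qed

lemma psd_sqrt_exists:
  assumes a: "a \<in> psd_cone n"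
  shows "\<exists>s\<in>psd_cone n. s * s = a"
proof -
  note ac = psd_coneD[OF a]
  obtain P d where P: "P \<in> orthogonal_group n" and ad: "a = transpose_mat P * (mat_diag n d * P)"
    using symmetric_diagonalization[OF ac(1,2)] by blast
  note Pc = orthogonal_groupD[OF P]
  have d: "d i \<ge> 0" if "i < n" for i
    using ac(3)[of "transpose_mat P *\<^sub>v unit_vec n i"] quadratic_form_eigenbasis[OF P that, of d] Pc(1)
    by (simp add: ad)
  define s where "s = transpose_mat P * (mat_diag n (\<lambda>i. sqrt (d i)) * P)"
  have s: "s \<in> carrier_mat n n" using Pc(1) by (simp add: s_def)
  have "s * s = transpose_mat P * (mat_diag n (\<lambda>i. sqrt (d i)) * (P * transpose_mat P) *
      (mat_diag n (\<lambda>i. sqrt (d i)) * P))"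
    using Pc(1) by (simp add: s_def assoc_mult_mat[of _ n n _ n _ n])
  also have "\<dots> = transpose_mat P * (mat_diag n (\<lambda>i. sqrt (d i)) * mat_diag n (\<lambda>i. sqrt (d i)) * P)"
    unfolding Pc(3) right_mult_one_mat[OF mat_diag_dim]
    by (simp only: assoc_mult_mat[OF mat_diag_dim mat_diag_dim Pc(1)])
  also have "\<dots> = transpose_mat P * (mat_diag n (\<lambda>i. sqrt (d i) * sqrt (d i)) * P)"
    by simp
  also have "mat_diag n (\<lambda>i. sqrt (d i) * sqrt (d i)) = mat_diag n d"
    by (rule eq_matI) (auto simp: mat_diag_def d)
  finally have "s * s = a" by (simp add: ad)
  moreover have "transpose_mat s = s"
  proof -
    have "transpose_mat (mat_diag n (\<lambda>i. sqrt (d i))) = mat_diag n (\<lambda>i. sqrt (d i))"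
      by (rule eq_matI) (auto simp: mat_diag_def)
    then show ?thesis
      using Pc(1) by (simp add: s_def transpose_mult[of _ n n _ n] assoc_mult_mat[of _ n n _ n _ n])
  qed
  moreover have "0 \<le> scalar_prod v (s *\<^sub>v v)" if "v \<in> carrier_vec n" for v
    unfolding s_def quadratic_form_diagonalized[OF Pc(1) that]
    by (intro sum_nonneg mult_nonneg_nonneg) (auto simp: d)
  ultimately show ?thesis using s by (auto simp: psd_cone_def)
qed

text \<open>Diagonalize the difference rather than one of the roots. For a unit eigenvector \<open>x\<close> of
  \<open>s - t\<close> with eigenvalue \<open>d\<close> the relation
  \<open>s x = t x + d x\<close> holds, while \<open>s x\<close> and \<open>t x\<close> have the same length
  because \<open>s\<^sup>2 = t\<^sup>2\<close>; hence \<open>d * (2 * x' t x + d) = 0\<close>. Both \<open>x' t x\<close> and \<open>x' s x = x' t x + d\<close> are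
  nonnegative, so \<open>d = 0\<close>. All eigenvalues of the symmetric matrix \<open>s - t\<close> vanish, and with them
  the matrix.\<close>

lemma psd_sqrt_unique:
  assumes s: "s \<in> psd_cone n" and t: "t \<in> psd_cone n" and eq: "s * s = t * t"
  shows "s = t"
proof -
  note sc = psd_coneD[OF s] and tc = psd_coneD[OF t]
  have "transpose_mat (s - t) = s - t"
    using sc(1,2) tc(1,2) by (metis transpose_minus)
  then obtain P d where P: "P \<in> orthogonal_group n"
    and D: "s - t = transpose_mat P * (mat_diag n d * P)"
    using symmetric_diagonalization[of "s - t" n] minus_carrier_mat[OF tc(1), of s] by blast
  note Pc = orthogonal_groupD[OF P]
  have "d i = 0" if i: "i < n" for i
  proof -
    define x where "x = transpose_mat P *\<^sub>v unit_vec n i"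
    have x: "x \<in> carrier_vec n" using Pc(1) by (simp add: x_def)
    let ?y = "s *\<^sub>v x" and ?z = "t *\<^sub>v x"
    have y: "?y \<in> carrier_vec n" and z: "?z \<in> carrier_vec n"
      using sc(1) tc(1) x by auto
    have Px: "P *\<^sub>v x = unit_vec n i"
      using Pc by (simp add: x_def assoc_mult_mat_vec[of _ n n _ n, symmetric])
    have "(s - t) *\<^sub>v x = transpose_mat P *\<^sub>v (mat_diag n d *\<^sub>v (P *\<^sub>v x))"
      unfolding D using Pc(1) x by (simp add: assoc_mult_mat_vec[of _ n n _ n])
    moreover have "mat_diag n d *\<^sub>v unit_vec n i = d i \<cdot>\<^sub>v unit_vec n i"
      using i by (intro eq_vecI) (auto simp: mat_diag_mult_vec simp del: index_mult_mat_vec, simp add: mat_diag_def)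
    ultimately have "(s - t) *\<^sub>v x = d i \<cdot>\<^sub>v x"
      using Pc(1) by (simp add: Px x_def[symmetric] mult_mat_vec[of _ n n])
    then have diff: "?y - ?z = d i \<cdot>\<^sub>v x"
      by (simp add: minus_mult_distrib_mat_vec[OF sc(1) tc(1) x])
    have yz: "?y = ?z + d i \<cdot>\<^sub>v x"
      unfolding diff[symmetric] using sc(1) tc(1) by (intro eq_vecI) auto
    have xx: "scalar_prod x x = 1"
      using scalar_prod_mult_mat_vec[OF Pc(1) x, of "unit_vec n i"] Px i
      by (simp add: x_def[symmetric])
    have "scalar_prod ?y ?y = scalar_prod x ((s * s) *\<^sub>v x)"
      using scalar_prod_mult_mat_vec[OF sc(1) x y] sc(1,2) x
      by (simp add: assoc_mult_mat_vec[of _ n n _ n])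
    also have "\<dots> = scalar_prod ?z ?z"
      unfolding eq using scalar_prod_mult_mat_vec[OF tc(1) x z] tc(1,2) x
      by (simp add: assoc_mult_mat_vec[of _ n n _ n])
    finally have sq: "scalar_prod ?y ?y = scalar_prod ?z ?z" .
    have "scalar_prod ?y ?y = scalar_prod ?z ?z + 2 * d i * scalar_prod x ?z + d i * d i"
      unfolding yz using x z xx comm_scalar_prod[OF x z]
      by (simp add: add_scalar_prod_distrib[of _ n] scalar_prod_add_distrib[of _ n] algebra_simps)
    then have 1: "d i * (2 * scalar_prod x ?z + d i) = 0"
      using sq by (simp add: algebra_simps)
    have "scalar_prod x ?y = scalar_prod x ?z + d i"
      unfolding yz using x z xx by (simp add: scalar_prod_add_distrib[of _ n])
    then have "scalar_prod x ?z + d i \<ge> 0" "scalar_prod x ?z \<ge> 0"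
      using sc(3)[OF x] tc(3)[OF x] by auto
    then show "d i = 0" using 1 by auto
  qed
  then have "mat_diag n d = 0\<^sub>m n n"
    by (intro eq_matI) (auto simp: mat_diag_def)
  then have zero: "s - t = 0\<^sub>m n n"
    using D Pc(1) by simp
  have "s $$ (i, j) = t $$ (i, j)" if "i < n" "j < n" for i j
    using arg_cong[OF zero, of "\<lambda>m. m $$ (i, j)"] that sc(1) tc(1) by simp
  then show "s = t"
    using sc(1) tc(1) by (intro eq_matI) auto
qed

lemma gram_matrix_psd:
  assumes x: "x \<in> carrier_mat p q"
  shows "transpose_mat x * x \<in> psd_cone q"
proof -
  have "0 \<le> scalar_prod v ((transpose_mat x * x) *\<^sub>v v)" if v: "v \<in> carrier_vec q" for v
  proof -
    have "scalar_prod v ((transpose_mat x * x) *\<^sub>v v) = scalar_prod (x *\<^sub>v v) (x *\<^sub>v v)"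
      using scalar_prod_mult_mat_vec[OF x v, of "x *\<^sub>v v"] x v
      by (simp add: assoc_mult_mat_vec[of _ q p _ q])
    then show ?thesis by (simp add: scalar_prod_def sum_nonneg)
  qed
  then show ?thesis
    using x by (auto simp: psd_cone_def transpose_mult[of _ q p _ q])
qed

lemma mat_abs:
  assumes x: "x \<in> carrier_mat p q"
  shows "mat_abs x \<in> psd_cone q" "mat_abs x * mat_abs x = transpose_mat x * x"
proof -
  let ?a = "transpose_mat x * x"
  have "\<exists>!s. s \<in> psd_cone (dim_row ?a) \<and> s * s = ?a"
    using psd_sqrt_exists[OF gram_matrix_psd[OF x]] psd_sqrt_unique[of _ q] x
    by auto
  from theI'[OF this] x show "mat_abs x \<in> psd_cone q" "mat_abs x * mat_abs x = ?a"
    by (auto simp: mat_abs_def mat_sqrt_def)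
qed

lemma mat_norm_mat_abs:
  assumes x: "x \<in> carrier_mat p q"
  shows "mat_norm (mat_abs x) = mat_norm x"
  using mat_abs[OF x] by (simp add: mat_norm_def psd_coneD(2)[OF mat_abs(1)[OF x]])

lemma mat_norm_eq:
  assumes "x \<in> carrier_mat p q"
  shows "mat_norm x = sqrt (\<Sum>j<q. \<Sum>i<p. (x $$ (i, j))\<^sup>2)"
  using assms
  by (auto simp: mat_norm_def mat_trace_def scalar_prod_def atLeast0LessThan power2_eq_square intro!: sum.cong)

section \<open>Khinchine's inequality for even moments\<close>

text \<open>Compare the power series term by term: \<open>(2 * n)! \<ge> n!\<close>.\<close>

lemma cosh_le_exp_power2: "cosh x \<le> exp (x\<^sup>2)" for x :: real
proof -
  have "(\<lambda>n. if even n then x ^ n /\<^sub>R fact n else 0) sums cosh x"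
    by (rule cosh_converges)
  then have "(\<lambda>n. (if even (2 * n) then x ^ (2 * n) /\<^sub>R fact (2 * n) else 0)) sums cosh x"
    by (subst sums_mono_reindex) (auto simp: strict_mono_def image_iff elim!: evenE)
  moreover have "(\<lambda>n. (x\<^sup>2) ^ n /\<^sub>R fact n) sums exp (x\<^sup>2)"
    by (rule exp_converges)
  moreover have "(if even (2 * n) then x ^ (2 * n) /\<^sub>R fact (2 * n) else 0) \<le> (x\<^sup>2) ^ n /\<^sub>R fact n" for n
  proof -
    have "inverse (fact (2 * n)) \<le> (inverse (fact n) :: real)"
      by (intro le_imp_inverse_le fact_mono) auto
    then show ?thesis
      by (simp add: power_mult mult_right_mono)
  qed
  ultimately show ?thesis
    by (rule sums_le[rotated])
qed

lemma power_le_fact_exp_abs: "x ^ n \<le> fact n * exp \<bar>x\<bar>" for x :: real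
proof -
  have "(\<lambda>n. \<bar>x\<bar> ^ n /\<^sub>R fact n) sums exp \<bar>x\<bar>"
    by (rule exp_converges)
  then have "(\<Sum>k\<in>{n}. \<bar>x\<bar> ^ k /\<^sub>R fact k) \<le> exp \<bar>x\<bar>"
    by (subst sums_unique, assumption, intro sum_le_suminf) (auto simp: sums_iff)
  then have "\<bar>x\<bar> ^ n \<le> fact n * exp \<bar>x\<bar>"
    by (simp add: field_simps)
  moreover have "x ^ n \<le> \<bar>x\<bar> ^ n"
    by (metis abs_ge_self power_abs)
  ultimately show ?thesis by linarith
qed

text \<open>A choice of signs on \<open>K\<close> is encoded by the set of indices with sign \<open>+1\<close>; a sum over all
  sign choices is then a sum over \<open>Pow K\<close>, the form in which \<open>prod_add\<close> expands a product of sums.\<close>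

definition subset_sign :: "'a set \<Rightarrow> 'a \<Rightarrow> real" where
  "subset_sign T k = (if k \<in> T then 1 else - 1)"

text \<open>The exponential moment of a sign sum factorizes into hyperbolic cosines.\<close>

lemma sum_signs_exp_le:
  fixes a :: "'a \<Rightarrow> real"
  assumes K: "finite K" and a: "(\<Sum>k\<in>K. (a k)\<^sup>2) \<le> 1"
  shows "(\<Sum>T\<in>Pow K. exp (\<Sum>k\<in>K. subset_sign T k * a k)) \<le> 2 ^ card K * exp 1"
proof -
  have "(\<Sum>T\<in>Pow K. exp (\<Sum>k\<in>K. subset_sign T k * a k))
      = (\<Sum>T\<in>Pow K. (\<Prod>k\<in>T. exp (a k)) * (\<Prod>k\<in>K - T. exp (- a k)))"
  proof (intro sum.cong refl)
    fix T assume "T \<in> Pow K"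
    then have T: "T \<subseteq> K" by simp
    have "exp (\<Sum>k\<in>K. subset_sign T k * a k) = (\<Prod>k\<in>K. exp (subset_sign T k * a k))"
      using K by (rule exp_sum)
    also have "\<dots> = (\<Prod>k\<in>K - T. exp (subset_sign T k * a k)) * (\<Prod>k\<in>T. exp (subset_sign T k * a k))"
      by (rule prod.subset_diff[OF T K])
    finally show "exp (\<Sum>k\<in>K. subset_sign T k * a k)
        = (\<Prod>k\<in>T. exp (a k)) * (\<Prod>k\<in>K - T. exp (- a k))"
      by (simp add: subset_sign_def)
  qed
  also have "\<dots> = (\<Prod>k\<in>K. exp (a k) + exp (- a k))"
    using K by (rule prod_add[symmetric])
  also have "\<dots> \<le> (\<Prod>k\<in>K. 2 * exp ((a k)\<^sup>2))"
    using cosh_le_exp_power2 by (intro prod_mono) (auto simp: cosh_def field_simps add_nonneg_nonneg)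
  also have "\<dots> = 2 ^ card K * exp (\<Sum>k\<in>K. (a k)\<^sup>2)"
    using K by (simp add: prod.distrib exp_sum)
  also have "\<dots> \<le> 2 ^ card K * exp 1"
    using a by simp
  finally show ?thesis .
qed

text \<open>After scaling to \<open>\<Sum> a\<^sub>k\<^sup>2 = 1\<close>, a power of the sign sum \<open>y\<close> is dominated by
  \<open>exp \<bar>y\<bar> \<le> exp y + exp (- y)\<close>, and both exponential moments are bounded independently of the
  number of terms. Averages over signs appear multiplied by their number \<open>2 ^ card K\<close>.\<close>

theorem khinchine_even_moment:
  fixes a :: "'a \<Rightarrow> real"
  assumes K: "finite K"
  shows "(\<Sum>T\<in>Pow K. (\<Sum>k\<in>K. subset_sign T k * a k) ^ (2 * l))
    \<le> 2 ^ card K * (2 * fact (2 * l) * exp 1) * (\<Sum>k\<in>K. (a k)\<^sup>2) ^ l"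
proof (cases "(\<Sum>k\<in>K. (a k)\<^sup>2) = 0")
  case True
  then have "a k = 0" if "k \<in> K" for k
    using that K by (simp add: sum_nonneg_eq_0_iff)
  then have "(\<Sum>T\<in>Pow K. (\<Sum>k\<in>K. subset_sign T k * a k) ^ (2 * l)) = 2 ^ card K * 0 ^ l"
    using K by (simp add: card_Pow power_mult)
  also have "(0::real) ^ l \<le> (2 * fact (2 * l) * exp 1) * 0 ^ l"
  proof -
    have "1 * 1 * 1 \<le> 2 * (fact (2 * l) :: real) * exp 1"
      by (intro mult_mono fact_ge_1) auto
    then show ?thesis by (cases l) auto
  qed
  finally show ?thesis by (simp add: True mult.assoc)
next
  case False
  define s where "s = sqrt (\<Sum>k\<in>K. (a k)\<^sup>2)"
  have s: "s > 0" "s\<^sup>2 = (\<Sum>k\<in>K. (a k)\<^sup>2)"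
    using False by (auto simp: s_def sum_nonneg less_le)
  define b where "b k = a k / s" for k
  have b: "(\<Sum>k\<in>K. (b k)\<^sup>2) \<le> 1" "(\<Sum>k\<in>K. (- b k)\<^sup>2) \<le> 1"
    using s False by (auto simp: b_def power_divide sum_divide_distrib[symmetric])
  have "(\<Sum>k\<in>K. subset_sign T k * a k) ^ (2 * l)
      \<le> (s\<^sup>2) ^ l * (fact (2 * l) * (exp (\<Sum>k\<in>K. subset_sign T k * b k)
                                  + exp (\<Sum>k\<in>K. subset_sign T k * - b k)))" for T
  proof -
    let ?y = "\<Sum>k\<in>K. subset_sign T k * b k"
    have "(\<Sum>k\<in>K. subset_sign T k * a k) = s * ?y"
      using s by (simp add: b_def sum_distrib_left)
    then have "(\<Sum>k\<in>K. subset_sign T k * a k) ^ (2 * l) = (s\<^sup>2) ^ l * ?y ^ (2 * l)"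
      by (simp add: power_mult_distrib power_mult)
    also have "\<dots> \<le> (s\<^sup>2) ^ l * (fact (2 * l) * exp \<bar>?y\<bar>)"
      by (intro mult_left_mono power_le_fact_exp_abs) auto
    also have "\<dots> \<le> (s\<^sup>2) ^ l * (fact (2 * l) * (exp ?y + exp (- ?y)))"
      by (intro mult_left_mono) (cases "?y \<ge> 0", auto)
    also have "- ?y = (\<Sum>k\<in>K. subset_sign T k * - b k)"
      by (simp add: sum_negf)
    finally show ?thesis .
  qed
  then have "(\<Sum>T\<in>Pow K. (\<Sum>k\<in>K. subset_sign T k * a k) ^ (2 * l))
      \<le> (\<Sum>T\<in>Pow K. (s\<^sup>2) ^ l * (fact (2 * l) * (exp (\<Sum>k\<in>K. subset_sign T k * b k)
                                  + exp (\<Sum>k\<in>K. subset_sign T k * - b k))))"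
    by (rule sum_mono)
  also have "\<dots> = (s\<^sup>2) ^ l * (fact (2 * l) * ((\<Sum>T\<in>Pow K. exp (\<Sum>k\<in>K. subset_sign T k * b k))
                                  + (\<Sum>T\<in>Pow K. exp (\<Sum>k\<in>K. subset_sign T k * - b k))))"
    by (simp only: sum_distrib_left[symmetric] sum.distrib)
  also have "\<dots> \<le> (s\<^sup>2) ^ l * (fact (2 * l) * (2 ^ card K * exp 1 + 2 ^ card K * exp 1))"
    using sum_signs_exp_le[OF K b(1)] sum_signs_exp_le[OF K b(2)]
    by (intro mult_left_mono add_mono) auto
  finally show ?thesis by (simp add: s(2) algebra_simps)
qed

text \<open>Each factor is at most the maximum, and the power of the maximum is one of the summands.\<close>

lemma prod_powers_le_sum_power:
  fixes f :: "'a \<Rightarrow> real"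
  assumes I: "finite I" "I \<noteq> {}" and f: "\<And>i. i \<in> I \<Longrightarrow> 0 \<le> f i"
  shows "(\<Prod>i\<in>I. f i ^ k i) \<le> (\<Sum>i\<in>I. f i ^ (\<Sum>i\<in>I. k i))"
proof -
  define M where "M = Max (f ` I)"
  have "(\<Prod>i\<in>I. f i ^ k i) \<le> (\<Prod>i\<in>I. M ^ k i)"
    using I f by (intro prod_mono) (auto simp: M_def intro!: power_mono)
  also have "\<dots> = M ^ (\<Sum>i\<in>I. k i)"
    by (rule power_sum[symmetric])
  also have "M \<in> f ` I"
    unfolding M_def using I by (intro Max_in) auto
  then have "M ^ (\<Sum>i\<in>I. k i) \<le> (\<Sum>i\<in>I. f i ^ (\<Sum>i\<in>I. k i))"
    using I f by (auto intro!: member_le_sum)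
  finally show ?thesis .
qed

section \<open>Borel measurability and radial measures\<close>

lemma space_borel_mat [simp]: "space (borel_mat p q) = carrier_mat p q"
  by (simp add: borel_mat_def)

lemma measurable_entry:
  assumes "i < p" "j < q"
  shows "(\<lambda>x. x $$ (i, j)) \<in> borel_measurable (borel_mat p q)"
proof -
  let ?F = "\<lambda>x. \<lambda>ij\<in>{..<p} \<times> {..<q}. x $$ ij"
  have "?F \<in> borel_mat p q \<rightarrow>\<^sub>M (\<Pi>\<^sub>M ij\<in>{..<p} \<times> {..<q}. borel)"
    unfolding borel_mat_def by (rule measurable_vimage_algebra1) (auto simp: space_PiM)
  then have "(\<lambda>x. ?F x (i, j)) \<in> borel_measurable (borel_mat p q)"
    by (rule measurable_compose[OF _ measurable_component_singleton]) (use assms in auto)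
  then show ?thesis using assms by simp
qed

lemma measurable_into_borel_mat:
  assumes "\<And>x. x \<in> space M \<Longrightarrow> f x \<in> carrier_mat p q"
    and "\<And>i j. i < p \<Longrightarrow> j < q \<Longrightarrow> (\<lambda>x. f x $$ (i, j)) \<in> borel_measurable M"
  shows "f \<in> M \<rightarrow>\<^sub>M borel_mat p q"
  unfolding borel_mat_def
  by (rule measurable_vimage_algebra2) (use assms in \<open>auto intro!: measurable_restrict\<close>)

lemma measurable_mat_norm: "mat_norm \<in> borel_measurable (borel_mat p q)"
proof -
  have "(\<lambda>x. sqrt (\<Sum>j<q. \<Sum>i<p. (x $$ (i, j))\<^sup>2)) \<in> borel_measurable (borel_mat p q)"
    by (intro measurable_compose[OF _ borel_measurable_sqrt] borel_measurable_sum borel_measurable_power measurable_entry) auto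
  then show ?thesis
    by (subst measurable_cong[where g = "\<lambda>x. sqrt (\<Sum>j<q. \<Sum>i<p. (x $$ (i, j))\<^sup>2)"])
      (simp_all add: mat_norm_eq)
qed

lemma measurable_left_mult:
  assumes A: "A \<in> carrier_mat p p"
  shows "(\<lambda>x. A * x) \<in> borel_mat p q \<rightarrow>\<^sub>M borel_mat p q"
proof (rule measurable_into_borel_mat)
  fix i j assume ij: "i < p" "j < q"
  have "(\<lambda>x. \<Sum>k<p. A $$ (i, k) * x $$ (k, j)) \<in> borel_measurable (borel_mat p q)"
    using ij by (intro borel_measurable_sum borel_measurable_times measurable_entry) auto
  then show "(\<lambda>x. (A * x) $$ (i, j)) \<in> borel_measurable (borel_mat p q)"
    by (subst measurable_cong[where g = "\<lambda>x. \<Sum>k<p. A $$ (i, k) * x $$ (k, j)"])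
      (use A ij in \<open>auto simp: scalar_prod_def atLeast0LessThan\<close>)
qed (use A in auto)

lemma radial_integral_invariant:
  fixes f :: "real mat \<Rightarrow> real"
  assumes "radial p \<mu>" and s: "sets \<mu> = sets (borel_mat p q)"
    and A: "A \<in> orthogonal_group p" and f: "f \<in> borel_measurable (borel_mat p q)"
  shows "(\<integral>x. f (A * x) \<partial>\<mu>) = (\<integral>x. f x \<partial>\<mu>)"
proof -
  have m: "(\<lambda>x. A * x) \<in> \<mu> \<rightarrow>\<^sub>M \<mu>"
    using measurable_left_mult[OF orthogonal_groupD(1)[OF A], of q]
    by (simp add: measurable_cong_sets[OF s s])
  have "(\<integral>x. f x \<partial>\<mu>) = (\<integral>x. f x \<partial>distr \<mu> \<mu> (\<lambda>x. A * x))"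
    using assms(1) A by (simp add: radial_def)
  also have "\<dots> = (\<integral>x. f (A * x) \<partial>\<mu>)"
    using m f by (intro integral_distr) (simp_all add: measurable_cong_sets[OF s refl])
  finally show ?thesis by simp
qed

text \<open>By definition \<open>distr\<close> yields the zero measure unless the image set function is a measure. So a
  nonzero image measure is given by its defining formula even if \<open>f\<close> is not known to be
  measurable.\<close>

lemma emeasure_distr_nonzero:
  assumes "emeasure (distr M N f) B \<noteq> 0" and A: "A \<in> sets N"
  shows "emeasure (distr M N f) A = emeasure M (f -` A \<inter> space M)"
proof -
  let ?m = "\<lambda>A. emeasure M (f -` A \<inter> space M)"
  have "measure_space (space N) (sets N) ?m"
  proof (rule ccontr)
    assume "\<not> ?thesis"
    then have "emeasure (distr M N f) B = 0"
      by (simp add: distr_def emeasure_measure_of_conv sets.sigma_sets_eq)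
    with assms(1) show False by contradiction
  qed
  then show ?thesis
    using A by (simp add: distr_def emeasure_measure_of_conv sets.sigma_sets_eq)
qed

text \<open>The event that \<open>mat_norm\<close> lies in \<open>B\<close> on the cone pulls back under \<open>mat_abs\<close> to the same event
  for matrices, because \<open>mat_abs\<close> preserves the norm. As \<open>\<nu>\<close> is a probability measure, the
  previous lemma evaluates its measure without a discussion of the measurability of the matrix
  square root, so the norm has the same distribution under both measures.\<close>

lemma nn_integral_mat_norm_radial_part:
  fixes g :: "real \<Rightarrow> ennreal"
  assumes r: "radial_prob_with_radial_part p q \<nu> \<mu>" and \<nu>: "prob_space \<nu>"
    and g: "g \<in> borel_measurable borel"
  shows "(\<integral>\<^sup>+ z. g (mat_norm z) \<partial>\<mu>) = (\<integral>\<^sup>+ s. g (mat_norm s) \<partial>\<nu>)"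
proof -
  have s: "sets \<mu> = sets (borel_mat p q)" and d: "distr \<mu> (borel_psd q) mat_abs = \<nu>"
    using r by (auto simp: radial_prob_with_radial_part_def)
  have sp: "space \<mu> = carrier_mat p q"
    using sets_eq_imp_space_eq[OF s] by simp
  have s': "sets \<nu> = sets (borel_psd q)" and sp': "space \<nu> = psd_cone q"
    by (auto simp: d[symmetric] borel_psd_def space_restrict_space psd_cone_def)
  have n: "mat_norm \<in> borel_measurable \<mu>"
    using measurable_mat_norm by (simp add: measurable_cong_sets[OF s refl])
  have n': "mat_norm \<in> borel_measurable \<nu>"
    unfolding measurable_cong_sets[OF s' refl] borel_psd_def
    by (rule measurable_restrict_space1[OF measurable_mat_norm])
  have "distr \<mu> borel mat_norm = distr \<nu> borel mat_norm"
  proof (rule measure_eqI)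
    fix B :: "real set" assume "B \<in> sets (distr \<mu> borel mat_norm)"
    then have B: "B \<in> sets borel" by simp
    have "emeasure \<nu> (space \<nu>) \<noteq> 0"
      using prob_space.emeasure_space_1[OF \<nu>] by simp
    \<comment> \<open>\<open>\<nu>\<close> has total mass one, so it is the image set function itself\<close>
    then have "emeasure \<nu> (mat_norm -` B \<inter> space \<nu>)
        = emeasure \<mu> (mat_abs -` (mat_norm -` B \<inter> space \<nu>) \<inter> space \<mu>)"
      using emeasure_distr_nonzero[of \<mu> "borel_psd q" mat_abs] measurable_sets[OF n' B]
      by (auto simp: d s')
    also have "mat_abs -` (mat_norm -` B \<inter> space \<nu>) \<inter> space \<mu> = mat_norm -` B \<inter> space \<mu>"
      using mat_abs(1) by (auto simp: sp sp' mat_norm_mat_abs)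
    finally show "emeasure (distr \<mu> borel mat_norm) B = emeasure (distr \<nu> borel mat_norm) B"
      using B n n' by (simp add: emeasure_distr)
  qed simp
  then show ?thesis
    using nn_integral_distr[OF n, of g] nn_integral_distr[OF n', of g] g by simp
qed


section \<open>Moments of radial measures\<close>

lemma add_zero_rows_index:
  assumes "\<kappa> \<in> carrier_mat p0 q" "p0 \<le> p" "i < p" "j < q"
  shows "add_zero_rows p \<kappa> $$ (i, j) = (if i < p0 then \<kappa> $$ (i, j) else 0)"
  using assms by (auto simp: add_zero_rows_def append_rows_def)

lemma mat_monom_add_zero_rows:
  assumes \<kappa>: "\<kappa> \<in> carrier_mat p0 q" "p0 \<le> p"
  shows "mat_monom z (add_zero_rows p \<kappa>) = (\<Prod>i<p0. \<Prod>j<q. z $$ (i, j) ^ \<kappa> $$ (i, j))"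
proof -
  have c: "add_zero_rows p \<kappa> \<in> carrier_mat p q"
    using carrier_append_rows[OF \<kappa>(1) zero_carrier_mat[of "p - p0" q]] \<kappa>
    by (auto simp: add_zero_rows_def)
  have "mat_monom z (add_zero_rows p \<kappa>)
      = (\<Prod>i<p. \<Prod>j<q. z $$ (i, j) ^ (if i < p0 then \<kappa> $$ (i, j) else 0))"
    unfolding mat_monom_def using c
    by (intro prod.cong) (auto simp: add_zero_rows_index[OF \<kappa>])
  also have "\<dots> = (\<Prod>i<p0. \<Prod>j<q. z $$ (i, j) ^ (if i < p0 then \<kappa> $$ (i, j) else 0))"
    using \<kappa>(2) by (intro prod.mono_neutral_right) auto
  also have "\<dots> = (\<Prod>i<p0. \<Prod>j<q. z $$ (i, j) ^ \<kappa> $$ (i, j))"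
    by (intro prod.cong) auto
  finally show ?thesis .
qed

lemma measurable_mat_monom:
  assumes "\<kappa> \<in> carrier_mat p0 q" "p0 \<le> p"
  shows "(\<lambda>z. mat_monom z (add_zero_rows p \<kappa>)) \<in> borel_measurable (borel_mat p q)"
  unfolding mat_monom_add_zero_rows[OF assms]
  using assms by (intro borel_measurable_prod borel_measurable_power measurable_entry) auto

lemma sum_entries_sq_le_mat_norm_sq:
  assumes z: "z \<in> carrier_mat p q" and j: "j < q"
  shows "(\<Sum>i<p. (z $$ (i, j))\<^sup>2) \<le> (mat_norm z)\<^sup>2"
proof -
  have "(\<Sum>i<p. (z $$ (i, j))\<^sup>2) \<le> (\<Sum>j<q. \<Sum>i<p. (z $$ (i, j))\<^sup>2)"
    using j by (intro member_le_sum[of j "{..<q}" "\<lambda>j. \<Sum>i<p. (z $$ (i, j))\<^sup>2"]) (auto intro: sum_nonneg)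
  then show ?thesis
    by (simp add: mat_norm_eq[OF z] sum_nonneg)
qed

lemma mat_norm_nonneg: "z \<in> carrier_mat p q \<Longrightarrow> 0 \<le> mat_norm z"
  by (simp add: mat_norm_eq sum_nonneg)

lemma abs_entry_le_mat_norm:
  assumes z: "z \<in> carrier_mat p q" and ij: "i < p" "j < q"
  shows "\<bar>z $$ (i, j)\<bar> \<le> mat_norm z"
proof -
  have "(z $$ (i, j))\<^sup>2 \<le> (\<Sum>i<p. (z $$ (i, j))\<^sup>2)"
    using ij by (intro member_le_sum[of i "{..<p}" "\<lambda>i. (z $$ (i, j))\<^sup>2"]) auto
  also have "\<dots> \<le> (mat_norm z)\<^sup>2"
    by (rule sum_entries_sq_le_mat_norm_sq[OF z ij(2)])
  finally show ?thesis
    using mat_norm_nonneg[OF z] by (simp add: abs_le_square_iff[symmetric])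
qed

text \<open>The first bound gives integrability. The second one reduces monomials to
  single entries at the cost of a sum whose length is independent of \<open>p\<close>.\<close>

lemma mat_monom_bounds:
  assumes \<kappa>: "\<kappa> \<in> carrier_mat p0 q" "p0 \<le> p" and z: "z \<in> carrier_mat p q"
  shows "\<bar>mat_monom z (add_zero_rows p \<kappa>)\<bar> \<le> mat_norm z ^ mat_degree \<kappa>"
    and "0 < p0 \<Longrightarrow> 0 < q \<Longrightarrow> \<bar>mat_monom z (add_zero_rows p \<kappa>)\<bar>
      \<le> (\<Sum>(i, j)\<in>{..<p0} \<times> {..<q}. \<bar>z $$ (i, j)\<bar> ^ mat_degree \<kappa>)"
proof -
  let ?I = "{..<p0} \<times> {..<q}"
  have eq: "\<bar>mat_monom z (add_zero_rows p \<kappa>)\<bar> = (\<Prod>ij\<in>?I. \<bar>z $$ ij\<bar> ^ \<kappa> $$ ij)"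
    unfolding mat_monom_add_zero_rows[OF \<kappa>]
    by (simp add: abs_prod power_abs prod.cartesian_product)
  have deg: "mat_degree \<kappa> = (\<Sum>ij\<in>?I. \<kappa> $$ ij)"
    using \<kappa> by (simp add: mat_degree_def sum.cartesian_product)
  have "(\<Prod>ij\<in>?I. \<bar>z $$ ij\<bar> ^ \<kappa> $$ ij) \<le> (\<Prod>ij\<in>?I. mat_norm z ^ \<kappa> $$ ij)"
    using \<kappa>(2) abs_entry_le_mat_norm[OF z] by (intro prod_mono) (auto intro!: power_mono)
  then show "\<bar>mat_monom z (add_zero_rows p \<kappa>)\<bar> \<le> mat_norm z ^ mat_degree \<kappa>"
    by (simp add: eq deg power_sum)
  show "\<bar>mat_monom z (add_zero_rows p \<kappa>)\<bar>
      \<le> (\<Sum>(i, j)\<in>?I. \<bar>z $$ (i, j)\<bar> ^ mat_degree \<kappa>)" if "0 < p0" "0 < q"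
    using prod_powers_le_sum_power[of ?I "\<lambda>ij. \<bar>z $$ ij\<bar>" "\<lambda>ij. \<kappa> $$ ij"] that
    by (simp add: eq deg case_prod_unfold lessThan_empty_iff)
qed

text \<open>The sign flip of row \<open>i\<close> is orthogonal and multiplies the monomial by \<open>-1\<close> to the power
  \<open>row_degree \<kappa> i\<close>.\<close>

lemma mat_moment_odd_row:
  assumes \<kappa>: "\<kappa> \<in> carrier_mat p0 q" "p0 \<le> p"
    and rad: "radial p \<mu>" and s: "sets \<mu> = sets (borel_mat p q)"
    and i: "i < p0" and odd: "odd (row_degree \<kappa> i)"
  shows "mat_moment (add_zero_rows p \<kappa>) \<mu> = 0"
proof -
  define f :: "nat \<Rightarrow> real" where "f k = (if k = i then - 1 else 1)" for k
  define A where "A = mat_diag p f"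
  have "transpose_mat A * A = 1\<^sub>m p"
  proof -
    have "transpose_mat A = A"
      by (rule eq_matI) (auto simp: A_def mat_diag_def)
    moreover have "(\<lambda>k. f k * f k) = (\<lambda>_. 1)"
      by (auto simp: f_def)
    ultimately show ?thesis by (simp add: A_def)
  qed
  then have A: "A \<in> orthogonal_group p"
    by (simp add: orthogonal_group_def A_def)
  have sp: "space \<mu> = carrier_mat p q"
    using sets_eq_imp_space_eq[OF s] by simp
  have flip: "mat_monom (A * z) (add_zero_rows p \<kappa>) = - mat_monom z (add_zero_rows p \<kappa>)"
    if z: "z \<in> carrier_mat p q" for z
  proof -
    have "mat_monom (A * z) (add_zero_rows p \<kappa>)
        = (\<Prod>a<p0. \<Prod>j<q. (f a * z $$ (a, j)) ^ \<kappa> $$ (a, j))"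
      unfolding mat_monom_add_zero_rows[OF \<kappa>] A_def mat_diag_mult_left[OF z]
      using \<kappa>(2) by (intro prod.cong) auto
    also have "\<dots> = (\<Prod>a<p0. f a ^ row_degree \<kappa> a) * mat_monom z (add_zero_rows p \<kappa>)"
      using \<kappa>(1) unfolding mat_monom_add_zero_rows[OF \<kappa>]
      by (simp add: power_mult_distrib prod.distrib row_degree_def power_sum)
    also have "(\<Prod>a<p0. f a ^ row_degree \<kappa> a) = (\<Prod>a<p0. if a = i then - 1 else 1)"
      by (intro prod.cong) (auto simp: f_def odd)
    also have "\<dots> = - 1"
      using i by simp
    finally show ?thesis by simp
  qed
  have "mat_moment (add_zero_rows p \<kappa>) \<mu> = (\<integral>z. mat_monom (A * z) (add_zero_rows p \<kappa>) \<partial>\<mu>)"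
    unfolding mat_moment_def
    by (rule radial_integral_invariant[OF rad s A measurable_mat_monom[OF \<kappa>], symmetric])
  also have "\<dots> = (\<integral>z. - mat_monom z (add_zero_rows p \<kappa>) \<partial>\<mu>)"
    by (intro Bochner_Integration.integral_cong) (auto simp: sp flip)
  finally show ?thesis
    by (simp add: mat_moment_def)
qed

text \<open>For every sign choice the row \<open>\<epsilon> / sqrt p\<close> is a unit vector, so the left side equals the moment
  of the corresponding sign sum of column \<open>j\<close> divided by \<open>p ^ l\<close>; averaging over all sign choices
  allows Khinchine's inequality to be applied under the integral.\<close>

lemma even_entry_moment_bound:
  assumes rad: "radial p \<mu>" and s: "sets \<mu> = sets (borel_mat p q)"
    and int: "integrable \<mu> (\<lambda>z. mat_norm z ^ (2 * l))"
    and ij: "i < p" "j < q"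
  shows "(\<integral>z. (z $$ (i, j)) ^ (2 * l) \<partial>\<mu>)
    \<le> 2 * fact (2 * l) * exp 1 * (\<integral>z. mat_norm z ^ (2 * l) \<partial>\<mu>) / real p ^ l"
proof -
  have sp: "space \<mu> = carrier_mat p q"
    using sets_eq_imp_space_eq[OF s] by simp
  have p: "0 < p" using ij by simp
  let ?X = "\<lambda>T z. (\<Sum>k<p. subset_sign T k * z $$ (k, j)) ^ (2 * l)"
  let ?C = "2 * fact (2 * l) * exp 1 :: real"
  have rotate: "(\<integral>z. (z $$ (i, j)) ^ (2 * l) \<partial>\<mu>) = (\<integral>z. ?X T z \<partial>\<mu>) / real p ^ l"
    and int_X: "integrable \<mu> (?X T)" for T
  proof -
    define u where "u k = subset_sign T k / sqrt p" for k
    have "(\<Sum>k<p. (u k)\<^sup>2) = 1"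
      using p by (simp add: u_def power_divide subset_sign_def if_distrib[of "\<lambda>x. x\<^sup>2"] cong: if_cong)
    then obtain A where A: "A \<in> orthogonal_group p" "\<And>k. k < p \<Longrightarrow> A $$ (i, k) = u k"
      using orthogonal_with_prescribed_row[OF ij(1)] by blast
    have eq: "((A * z) $$ (i, j)) ^ (2 * l) = ?X T z / real p ^ l" if z: "z \<in> carrier_mat p q" for z
    proof -
      have "(A * z) $$ (i, j) = (\<Sum>k<p. u k * z $$ (k, j))"
        using z ij orthogonal_groupD(1)[OF A(1)] A(2) by (simp add: scalar_prod_def atLeast0LessThan)
      also have "\<dots> = (\<Sum>k<p. subset_sign T k * z $$ (k, j)) / sqrt p"
        by (simp add: u_def sum_divide_distrib)
      finally show ?thesis
        using p by (simp add: power_divide power_mult)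
    qed
    have "(\<integral>z. (z $$ (i, j)) ^ (2 * l) \<partial>\<mu>) = (\<integral>z. ((A * z) $$ (i, j)) ^ (2 * l) \<partial>\<mu>)"
      using ij by (intro radial_integral_invariant[OF rad s A(1), symmetric] borel_measurable_power measurable_entry)
    also have "\<dots> = (\<integral>z. ?X T z / real p ^ l \<partial>\<mu>)"
      by (intro Bochner_Integration.integral_cong refl eq) (simp add: sp)
    finally show "(\<integral>z. (z $$ (i, j)) ^ (2 * l) \<partial>\<mu>) = (\<integral>z. ?X T z \<partial>\<mu>) / real p ^ l"
      by simp
    have "(\<lambda>z. ?X T z) \<in> borel_measurable (borel_mat p q)"
      using ij(2) by (intro borel_measurable_power borel_measurable_sum borel_measurable_times
          borel_measurable_const measurable_entry) auto
    then have m: "?X T \<in> borel_measurable \<mu>"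
      by (simp add: measurable_cong_sets[OF s refl])
    \<comment> \<open>a crude bound growing with \<open>p\<close> is enough for integrability\<close>
    show "integrable \<mu> (?X T)"
    proof (rule Bochner_Integration.integrable_bound[of _ "\<lambda>z. real p ^ (2 * l) * mat_norm z ^ (2 * l)"])
      show "integrable \<mu> (\<lambda>z. real p ^ (2 * l) * mat_norm z ^ (2 * l))"
        using int by simp
      show "AE z in \<mu>. norm (?X T z) \<le> norm (real p ^ (2 * l) * mat_norm z ^ (2 * l))"
      proof (rule AE_I2)
        fix z assume "z \<in> space \<mu>"
        then have z: "z \<in> carrier_mat p q" by (simp add: sp)
        have "\<bar>\<Sum>k<p. subset_sign T k * z $$ (k, j)\<bar> \<le> (\<Sum>k<p. \<bar>subset_sign T k * z $$ (k, j)\<bar>)"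
          by (rule sum_abs)
        also have "\<dots> \<le> (\<Sum>k<p. mat_norm z)"
          using abs_entry_le_mat_norm[OF z _ ij(2)] by (intro sum_mono) (auto simp: subset_sign_def)
        finally have "\<bar>\<Sum>k<p. subset_sign T k * z $$ (k, j)\<bar> ^ (2 * l) \<le> (real p * mat_norm z) ^ (2 * l)"
          by (intro power_mono) auto
        then show "norm (?X T z) \<le> norm (real p ^ (2 * l) * mat_norm z ^ (2 * l))"
          using mat_norm_nonneg[OF z] by (simp add: power_mult_distrib power_abs)
      qed
    qed (rule m)
  qed
  have "2 ^ p * (\<integral>z. (z $$ (i, j)) ^ (2 * l) \<partial>\<mu>)
      = (\<Sum>T\<in>Pow {..<p}. \<integral>z. (z $$ (i, j)) ^ (2 * l) \<partial>\<mu>)"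
    by (simp add: card_Pow)
  also have "\<dots> = (\<Sum>T\<in>Pow {..<p}. (\<integral>z. ?X T z \<partial>\<mu>) / real p ^ l)"
    by (intro sum.cong refl rotate)
  also have "\<dots> = (\<integral>z. (\<Sum>T\<in>Pow {..<p}. ?X T z) \<partial>\<mu>) / real p ^ l"
    by (simp add: sum_divide_distrib[symmetric] Bochner_Integration.integral_sum int_X)
  also have "\<dots> \<le> (\<integral>z. 2 ^ p * ?C * mat_norm z ^ (2 * l) \<partial>\<mu>) / real p ^ l"
  proof (intro divide_right_mono integral_mono)
    fix z assume "z \<in> space \<mu>"
    then have z: "z \<in> carrier_mat p q" by (simp add: sp)
    have "(\<Sum>T\<in>Pow {..<p}. ?X T z) \<le> 2 ^ p * ?C * (\<Sum>k<p. (z $$ (k, j))\<^sup>2) ^ l"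
      using khinchine_even_moment[of "{..<p}" "\<lambda>k. z $$ (k, j)" l] by simp
    also have "\<dots> \<le> 2 ^ p * ?C * ((mat_norm z)\<^sup>2) ^ l"
      using sum_entries_sq_le_mat_norm_sq[OF z ij(2)]
      by (intro mult_left_mono power_mono) (auto intro: sum_nonneg)
    finally show "(\<Sum>T\<in>Pow {..<p}. ?X T z) \<le> 2 ^ p * ?C * mat_norm z ^ (2 * l)"
      by (simp add: power_mult)
  qed (use int int_X in auto)
  also have "\<dots> = 2 ^ p * (?C * (\<integral>z. mat_norm z ^ (2 * l) \<partial>\<mu>) / real p ^ l)"
    by simp
  finally show ?thesis
    by (simp only: mult_le_cancel_left_pos zero_less_power zero_less_numeral)
qed

theorem theorem2p10:
  fixes q p0 :: nat and \<kappa> :: "nat mat"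
    and \<nu> :: "real mat measure" and \<nu>p :: "nat \<Rightarrow> real mat measure"
  assumes "1 \<le> q" and "q \<le> p0"
    and "\<kappa> \<in> carrier_mat p0 q"
    and "prob_space \<nu>" and "sets \<nu> = sets (borel_psd q)"
    and "\<And>p. p \<ge> p0 \<Longrightarrow> radial_prob_with_radial_part p q \<nu> (\<nu>p p)"
    and "(\<integral>\<^sup>+ s. ennreal (mat_norm s ^ mat_degree \<kappa>) \<partial>\<nu>) < \<infinity>"
  shows "(\<forall>p\<ge>p0. (\<integral>\<^sup>+ z. ennreal (mat_norm z ^ mat_degree \<kappa>) \<partial>\<nu>p p)
                 = (\<integral>\<^sup>+ s. ennreal (mat_norm s ^ mat_degree \<kappa>) \<partial>\<nu>)) \<and>
         (\<forall>p\<ge>p0. integrable (\<nu>p p) (\<lambda>z. mat_monom z (add_zero_rows p \<kappa>))) \<and>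
         ((\<forall>i<p0. even (row_degree \<kappa> i)) \<longrightarrow>
           (\<lambda>p. mat_moment (add_zero_rows p \<kappa>) (\<nu>p p))
             \<in> O(\<lambda>p. real p powr (- (real (mat_degree \<kappa>) / 2)))) \<and>
         ((\<exists>i<p0. odd (row_degree \<kappa> i)) \<longrightarrow>
           (\<forall>p\<ge>p0. mat_moment (add_zero_rows p \<kappa>) (\<nu>p p) = 0))"
proof -
  note \<kappa> = assms(3) and \<nu> = assms(4) and rad = assms(6)
  let ?d = "mat_degree \<kappa>"
  define N where "N = (\<integral>\<^sup>+ s. ennreal (mat_norm s ^ ?d) \<partial>\<nu>)"
  have N: "N < \<infinity>" using assms(7) by (simp add: N_def)
  have s: "sets (\<nu>p p) = sets (borel_mat p q)" and rp: "radial p (\<nu>p p)" if "p0 \<le> p" for p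
    using rad[OF that] by (auto simp: radial_prob_with_radial_part_def)
  have sp: "space (\<nu>p p) = carrier_mat p q" if "p0 \<le> p" for p
    using sets_eq_imp_space_eq[OF s[OF that]] by simp
  have norm_moment: "(\<integral>\<^sup>+ z. ennreal (mat_norm z ^ ?d) \<partial>\<nu>p p) = N" if "p0 \<le> p" for p
    unfolding N_def using nn_integral_mat_norm_radial_part[OF rad[OF that] \<nu>, of "\<lambda>x. ennreal (x ^ ?d)"]
    by simp
  have norm_measurable: "(\<lambda>z. mat_norm z ^ ?d) \<in> borel_measurable (\<nu>p p)" if "p0 \<le> p" for p
    unfolding measurable_cong_sets[OF s[OF that] refl]
    by (intro borel_measurable_power measurable_mat_norm)
  have norm_nonneg: "AE z in \<nu>p p. 0 \<le> mat_norm z ^ ?d" if "p0 \<le> p" for p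
    by (rule AE_I2) (use mat_norm_nonneg in \<open>auto simp: sp[OF that]\<close>)
  have norm_integrable: "integrable (\<nu>p p) (\<lambda>z. mat_norm z ^ ?d)" if "p0 \<le> p" for p
    using norm_measurable[OF that] norm_nonneg[OF that] N norm_moment[OF that]
    by (intro integrableI_nonneg) auto
  have norm_integral: "(\<integral>z. mat_norm z ^ ?d \<partial>\<nu>p p) = enn2real N" if "p0 \<le> p" for p
    using integral_eq_nn_integral[OF norm_measurable[OF that] norm_nonneg[OF that]]
    by (simp add: norm_moment[OF that])
  have monom_integrable: "integrable (\<nu>p p) (\<lambda>z. mat_monom z (add_zero_rows p \<kappa>))" if p: "p0 \<le> p" for p
  proof (rule Bochner_Integration.integrable_bound[OF norm_integrable[OF p]])
    show "(\<lambda>z. mat_monom z (add_zero_rows p \<kappa>)) \<in> borel_measurable (\<nu>p p)"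
      unfolding measurable_cong_sets[OF s[OF p] refl] by (rule measurable_mat_monom[OF \<kappa> p])
    show "AE z in \<nu>p p. norm (mat_monom z (add_zero_rows p \<kappa>)) \<le> norm (mat_norm z ^ ?d)"
      by (rule AE_I2) (use mat_monom_bounds(1)[OF \<kappa> p] mat_norm_nonneg in \<open>auto simp: sp[OF p]\<close>)
  qed
  have even_case: "(\<lambda>p. mat_moment (add_zero_rows p \<kappa>) (\<nu>p p))
      \<in> O(\<lambda>p. real p powr (- (real ?d / 2)))" if even: "\<forall>i<p0. even (row_degree \<kappa> i)"
  proof -
    have "?d = (\<Sum>i<p0. row_degree \<kappa> i)"
      using \<kappa> by (simp add: mat_degree_def row_degree_def)
    then have "even ?d"
      using even by (auto intro!: dvd_sum)
    then obtain l where l: "?d = 2 * l" by (elim evenE)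
    define C where "C = real (p0 * q) * (2 * fact (2 * l) * exp 1 * enn2real N)"
    have bound: "\<bar>mat_moment (add_zero_rows p \<kappa>) (\<nu>p p)\<bar> \<le> C / real p ^ l" if p: "p0 \<le> p" for p
    proof -
      have int: "integrable (\<nu>p p) (\<lambda>z. (z $$ (i, j)) ^ (2 * l))" if "i < p0" "j < q" for i j
      proof (rule Bochner_Integration.integrable_bound[OF norm_integrable[OF p]])
        show "(\<lambda>z. (z $$ (i, j)) ^ (2 * l)) \<in> borel_measurable (\<nu>p p)"
          unfolding measurable_cong_sets[OF s[OF p] refl]
          using that p by (intro borel_measurable_power measurable_entry) auto
        have "\<bar>z $$ (i, j)\<bar> ^ (2 * l) \<le> \<bar>mat_norm z\<bar> ^ (2 * l)" if "z \<in> carrier_mat p q" for z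
          using abs_entry_le_mat_norm[OF that, of i j] \<open>i < p0\<close> \<open>j < q\<close> p
          by (intro power_mono) auto
        then show "AE z in \<nu>p p. norm ((z $$ (i, j)) ^ (2 * l)) \<le> norm (mat_norm z ^ ?d)"
          by (intro AE_I2) (simp add: l sp[OF p] power_abs)
      qed
      have "\<bar>mat_moment (add_zero_rows p \<kappa>) (\<nu>p p)\<bar> \<le> (\<integral>z. \<bar>mat_monom z (add_zero_rows p \<kappa>)\<bar> \<partial>\<nu>p p)"
        unfolding mat_moment_def by (rule integral_abs_bound)
      also have "\<dots> \<le> (\<integral>z. (\<Sum>(i, j)\<in>{..<p0} \<times> {..<q}. (z $$ (i, j)) ^ (2 * l)) \<partial>\<nu>p p)"
      proof (intro integral_mono)
        show "integrable (\<nu>p p) (\<lambda>z. \<bar>mat_monom z (add_zero_rows p \<kappa>)\<bar>)"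
          using monom_integrable[OF p] by simp
        show "integrable (\<nu>p p) (\<lambda>z. \<Sum>(i, j)\<in>{..<p0} \<times> {..<q}. (z $$ (i, j)) ^ (2 * l))"
          using int by (intro Bochner_Integration.integrable_sum) auto
        fix z assume "z \<in> space (\<nu>p p)"
        then show "\<bar>mat_monom z (add_zero_rows p \<kappa>)\<bar>
            \<le> (\<Sum>(i, j)\<in>{..<p0} \<times> {..<q}. (z $$ (i, j)) ^ (2 * l))"
          using mat_monom_bounds(2)[OF \<kappa> p, of z] assms(1,2) by (simp add: sp[OF p] l power_even_abs)
      qed
      also have "\<dots> = (\<Sum>(i, j)\<in>{..<p0} \<times> {..<q}. \<integral>z. (z $$ (i, j)) ^ (2 * l) \<partial>\<nu>p p)"
        using int by (subst Bochner_Integration.integral_sum) (auto simp: case_prod_unfold)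
      also have "\<dots> \<le> (\<Sum>(i, j)\<in>{..<p0} \<times> {..<q}. 2 * fact (2 * l) * exp 1 * enn2real N / real p ^ l)"
        using even_entry_moment_bound[OF rp[OF p] s[OF p], of l] norm_integrable[OF p] norm_integral[OF p] p
        by (intro sum_mono) (auto simp: l)
      also have "\<dots> = C / real p ^ l"
        by (simp add: C_def)
      finally show ?thesis .
    qed
    show ?thesis
    proof (rule bigoI)
      show "eventually (\<lambda>p. norm (mat_moment (add_zero_rows p \<kappa>) (\<nu>p p))
          \<le> C * norm (real p powr (- (real ?d / 2)))) at_top"
        \<comment> \<open>\<open>0 powr a\<close> is \<open>0\<close> even for \<open>a \<le> 0\<close>, hence \<open>p \<ge> 1\<close>\<close>
        using eventually_ge_at_top[of "max 1 p0"]
      proof eventually_elim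
        case (elim p)
        have "real p powr (- (real ?d / 2)) = inverse (real p powr real l)"
          by (simp only: l powr_minus of_nat_mult) simp
        also have "\<dots> = 1 / real p ^ l"
          using elim by (simp add: powr_realpow divide_inverse)
        finally show ?case
          using bound[of p] elim by (simp only:) simp
      qed
    qed
  qed
  have odd_case: "mat_moment (add_zero_rows p \<kappa>) (\<nu>p p) = 0"
    if "i < p0" "odd (row_degree \<kappa> i)" "p0 \<le> p" for i p
    using mat_moment_odd_row[OF \<kappa> that(3) rp[OF that(3)] s[OF that(3)] that(1,2)] .
  show ?thesis
    using norm_moment monom_integrable even_case odd_case unfolding N_def by blast
qed

end
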